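(* Let $(S_n)_{n\in\mathbb{N}}$ be the position of the $d$-dimensional walk with memory and random tendency with parameters $K\in\{2d,2d+1\}$ and $p,\theta\in[0,1]$. Then, almost surely, $$\lim_{n\to\infty}\frac{S_n}{n}=\frac{(1-\theta)(Kp-1)}{K-1+\theta(1-Kp)}\,(1,0,\ldots,0)^T .$$
   Context: Model (walk with memory and random tendency). Let $d\ge1$ and let $(e_1,\ldots,e_d)$ be the canonical basis of $\mathbb{R}^d$. The set of directions is $E_d=\{e_1,-e_1,\ldots,e_d,-e_d\}$ if $K=2d$ (even), and $E_d=\{e_1,-e_1,\ldots,e_d,-e_d,\mathbf{0}\}$ if $K=2d+1$ (odd), where $\mathbf{0}$ means no movement; thus $|E_d|=K$. The steps $X_1,X_2,\ldots$ take values in $E_d$, and $S_n=\sum_{i=1}^n X_i\in\mathbb{R}^d$ is the position of the walker at time $n$. No condition is imposed on the law of the first step $X_1$. Let $(Y_n)_{n\ge1}$ be a latent sequence of i.i.d. Bernoulli random variables with parameter $\theta$ (i.e. $P(Y_n=1)=\theta$), with $Y_n$ a coin flip independent of $X_1,\ldots,X_n$. Given $X_1,\ldots,X_n$ ($n\ge1$), the step $X_{n+1}$ is generated as follows: - if $Y_n=1$, choose $t\in\{1,\ldots,n\}$ uniformly at random; then $X_{n+1}=X_t$ with probability $p$, and otherwise $X_{n+1}$ equals any one of the other $K-1$ elements of $E_d$, each with probability $\frac{1-p}{K-1}$; - if $Y_n=0$, then $X_{n+1}=e_1$ with probability $p$, and $X_{n+1}$ equals any one of the other $K-1$ elements of $E_d$,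 each with probability $\frac{1-p}{K-1}$.
   Formalization: The denominator K-1+θ(1-Kp) is assumed nonzero, which excludes only p=θ=1, where the stated limit is 0/0 and S_n/n equals the arbitrary first step X_1. *)

theory Defs
  imports "HOL-Probability.Probability"
begin

text \<open>The walk lives in \<^typ>\<open>real ^ 'd\<close>, so \<open>d = CARD('d)\<close>. As a finite index type
  carries no order, the index of the first coordinate is a parameter \<open>j\<close> and
  \<open>e\<^sub>1 = axis j 1\<close>.\<close>

definition directions :: "nat \<Rightarrow> (real ^ 'd) set" where
  "directions K = range (\<lambda>i. axis i 1) \<union> range (\<lambda>i. - axis i 1) \<union>
     (if K = 2 * CARD('d) + 1 then {0} else {})"

definition perturb :: "'v set \<Rightarrow> real \<Rightarrow> 'v \<Rightarrow> 'v pmf" where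
  "perturb E p u =
     bind_pmf (bernoulli_pmf p) (\<lambda>b. if b then return_pmf u else pmf_of_set (E - {u}))"

text \<open>Law of the step \<open>n + 1\<close>, given the steps \<open>x 1, \<dots>, x n\<close> and the coin \<open>y\<close>.\<close>

definition next_step :: "nat \<Rightarrow> real \<Rightarrow> 'd \<Rightarrow> nat \<Rightarrow> (nat \<Rightarrow> real ^ 'd) \<Rightarrow> bool \<Rightarrow> (real ^ 'd) pmf" where
  "next_step K p j n x y =
     (if y then bind_pmf (pmf_of_set {1..n}) (\<lambda>t. perturb (directions K) p (x t))
      else perturb (directions K) p (axis j 1))"

text \<open>The steps \<open>X n\<close> and coins \<open>Y n\<close> are indexed by \<open>n \<ge> 1\<close>; index 0 is unconstrained, and so is
  the law of \<open>X 1\<close>. The steps take finitely many values, so elementary conditional probabilities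
  on the histories of positive probability determine their conditional law. The independence
  of \<open>Y n\<close> from \<open>X 1, \<dots>, X n\<close> is that of the generated sigma-algebras (\<^const>\<open>vimage_algebra\<close>):
  \<open>indep_var\<close> would need both variables to have the same codomain type.\<close>

locale memory_walk = prob_space M
  for M :: "'a measure" +
  fixes K :: nat and p \<theta> :: real and j :: "'d::finite"
    and X :: "nat \<Rightarrow> 'a \<Rightarrow> real ^ 'd" and Y :: "nat \<Rightarrow> 'a \<Rightarrow> bool"
  assumes K: "K \<in> {2 * CARD('d), 2 * CARD('d) + 1}"
    and p: "p \<in> {0..1}"
    and theta: "\<theta> \<in> {0..1}"
    and X_measurable: "\<And>n. n \<ge> 1 \<Longrightarrow> X n \<in> M \<rightarrow>\<^sub>M count_space (directions K)"
    and Y_indep: "indep_vars (\<lambda>_. count_space UNIV) Y {1..}"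
    and Y_distr: "\<And>n. n \<ge> 1 \<Longrightarrow> distr M (count_space UNIV) (Y n) = measure_pmf (bernoulli_pmf \<theta>)"
    and X_Y_indep: "\<And>n. n \<ge> 1 \<Longrightarrow>
      indep_set
        (sets (vimage_algebra (space M) (\<lambda>\<omega>. \<lambda>i\<in>{1..n}. X i \<omega>)
          (Pi\<^sub>M {1..n} (\<lambda>_. count_space (directions K)))))
        (sets (vimage_algebra (space M) (Y n) (count_space UNIV)))"
    and X_step: "\<And>n x y v. n \<ge> 1 \<Longrightarrow>
      \<P>(\<omega> in M. (\<forall>i\<in>{1..n}. X i \<omega> = x i) \<and> Y n \<omega> = y) > 0 \<Longrightarrow>
      \<P>(\<omega> in M. X (n + 1) \<omega> = v \<bar> (\<forall>i\<in>{1..n}. X i \<omega> = x i) \<and> Y n \<omega> = y)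
        = pmf (next_step K p j n x y) v"

definition position :: "(nat \<Rightarrow> 'a \<Rightarrow> real ^ 'd) \<Rightarrow> nat \<Rightarrow> 'a \<Rightarrow> real ^ 'd" where
  "position X n \<omega> = (\<Sum>i=1..n. X i \<omega>)"

lemma card_directions:
  assumes "K \<in> {2 * CARD('d), 2 * CARD('d) + 1}"
  shows "card (directions K :: (real ^ 'd) set) = K"
proof -
  let ?A = "range (\<lambda>i. axis i 1) :: (real ^ 'd) set"
  let ?B = "range (\<lambda>i. - axis i 1) :: (real ^ 'd) set"
  have neq: "axis i 1 \<noteq> - (axis k 1 :: real ^ 'd)" for i k
  proof
    assume "axis i 1 = - (axis k 1 :: real ^ 'd)"
    then have "(axis i 1 :: real ^ 'd) $ i = (- axis k 1 :: real ^ 'd) $ i" by simp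
    then show False by (simp add: axis_def split: if_splits)
  qed
  have disj: "?A \<inter> ?B = {}"
    using neq by blast
  have "inj (\<lambda>i. axis i 1 :: real ^ 'd)" "inj (\<lambda>i. - axis i 1 :: real ^ 'd)"
    by (auto simp: inj_on_def axis_eq_axis)
  then have "card (?A \<union> ?B) = 2 * CARD('d)"
    using disj by (simp add: card_Un_disjoint card_image)
  moreover have "0 \<notin> ?A \<union> ?B"
    by (auto simp: axis_eq_0_iff dest: sym)
  ultimately show ?thesis
    using assms by (auto simp: directions_def)
qed

lemma pmf_perturb:
  assumes "finite E" "u \<in> E" "v \<in> E" "card E \<ge> 2" "p \<in> {0..1}"
  shows "pmf (perturb E p u) v = (if v = u then p else (1 - p) / (real (card E) - 1))"
proof -
  have "card (E - {u}) = card E - 1"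
    using assms by simp
  moreover from this assms have "E - {u} \<noteq> {}"
    by (metis card.empty diff_is_0_eq not_less_eq_eq numeral_2_eq_2 One_nat_def)
  ultimately show ?thesis
    using assms by (auto simp: perturb_def pmf_bind pmf_of_set indicator_def of_nat_diff)
qed

end

theory Submission
  imports Defs "HOL-Computational_Algebra.Nth_Powers" "HOL-Real_Asymp.Real_Asymp"
begin

text \<open>A perturbation of the direction \<open>u\<close> has mean \<open>a u\<close> with \<open>a = (K p - 1) / (K - 1)\<close>, because the
  directions sum to 0. Hence \<open>S\<^sub>n\<close> has conditional drift \<open>\<theta> a S\<^sub>n / n + (1 - \<theta>) a e\<^sub>1\<close>, and for
  \<open>c = (1 - \<theta>) a / (1 - \<theta> a)\<close> the centred walk \<open>T\<^sub>n = S\<^sub>n - n c e\<^sub>1\<close> has drift \<open>\<theta> a T\<^sub>n / n\<close>. As the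
  increments are bounded, \<open>E|T\<^sub>n\<^sub>+\<^sub>1|\<^sup>2 \<le> (1 + 2 \<theta> a / n) E|T\<^sub>n|\<^sup>2 + C\<close> with \<open>\<theta> a < 1\<close>, so
  \<open>E|T\<^sub>n|\<^sup>2 = O(n\<^sup>r)\<close> for some \<open>r < 2\<close>. Along \<open>n = k\<^sup>m\<close> with \<open>m (2 - r) > 1\<close> the second moments of
  \<open>T\<^sub>n / n\<close> are summable, which gives almost sure convergence on this subsequence; bounded
  increments fill the gaps.\<close>

section \<open>Deterministic estimates: growth of a recursion, convergence along powers\<close>

text \<open>The right side minus the left vanishes at 0 and has derivative
  \<open>r * (1 + t) powr (r - 1) - r\<close>, which is nonnegative for
  \<open>t \<ge> 0\<close>.\<close>

lemma Bernoulli_inequality_powr: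
  fixes x r :: real
  assumes "x \<ge> 0" "r \<ge> 1"
  shows "1 + r * x \<le> (1 + x) powr r"
proof -
  have "(1 + 0) powr r - r * 0 \<le> (1 + x) powr r - r * x"
  proof (rule DERIV_nonneg_imp_nondecreasing[OF assms(1)])
    fix t :: real
    assume "0 \<le> t" "t \<le> x"
    then have "((\<lambda>t. (1 + t) powr r - r * t) has_real_derivative
        r * (1 + t) powr (r - 1) - r) (at t)"
      by (auto intro!: derivative_eq_intros)
    moreover have "1 \<le> (1 + t) powr (r - 1)"
      using \<open>0 \<le> t\<close> assms(2) by (intro ge_one_powr_ge_zero) auto
    then have "0 \<le> r * (1 + t) powr (r - 1) - r"
      using assms(2) by simp
    ultimately show "\<exists>y. ((\<lambda>t. (1 + t) powr r - r * t) has_real_derivative y) (at t) \<and> 0 \<le> y"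
      by blast
  qed
  then show ?thesis
    by simp
qed

text \<open>With \<open>\<beta> = max \<alpha> 0\<close>, a multiple of
  \<open>n powr (1 + \<beta>)\<close> is a supersolution of the recursion. The factor alone suggests
  order 2\<alpha> and the constant alone order 1; the exponent 1 + \<beta> is at least 2\<beta> and
  at least 1, which avoids comparing 2\<alpha> with 1 and the logarithm in the critical case
  2\<alpha> = 1.\<close>

lemma growth_exponent_less_2:
  fixes q :: "nat \<Rightarrow> real"
  assumes "\<alpha> < 1" "C \<ge> 0" and nonneg: "\<And>n. q n \<ge> 0"
    and step: "\<And>n. n \<ge> 1 \<Longrightarrow> q (Suc n) \<le> (1 + 2 * \<alpha> / real n) * q n + C"
  obtains A r where "r < 2" "\<And>n. n \<ge> 1 \<Longrightarrow> q n \<le> A * real n powr r"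
proof
  define \<beta> where "\<beta> = max \<alpha> 0"
  define r where "r = 1 + \<beta>"
  \<comment> \<open>The first entry settles \<open>n = 1\<close>; the second gives
    \<open>C \<le> A * (1 - \<beta>)\<close>, so that the induction step can absorb
    \<open>C\<close>.\<close>
  define A where "A = max (q 1) (C / (1 - \<beta>))"
  have \<beta>: "0 \<le> \<beta>" "\<beta> < 1" "\<alpha> \<le> \<beta>"
    using assms(1) by (auto simp: \<beta>_def)
  have A: "A \<ge> 0" "C \<le> A * (1 - \<beta>)"
    using \<beta> nonneg[of 1] \<open>C \<ge> 0\<close> by (auto simp: A_def le_max_iff_disj field_simps max_def)
  show "r < 2"
    using \<beta> by (simp add: r_def)
  show "q n \<le> A * real n powr r" if "n \<ge> 1" for n
    using that
  proof (induction n rule: nat_induct_at_least)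
    case base
    then show ?case by (simp add: A_def)
  next
    case (Suc n)
    have "q (Suc n) \<le> (1 + 2 * \<alpha> / real n) * q n + C"
      using step Suc.hyps by simp
    also have "\<dots> \<le> (1 + 2 * \<beta> / real n) * q n + C"
      using \<beta> nonneg[of n] by (intro add_right_mono mult_right_mono) (auto intro: divide_right_mono)
    \<comment> \<open>\<open>C\<close> is inflated to order
      \<open>n powr \<beta> = n powr r / n\<close>. The coefficients 2\<beta> and 1 - \<beta> of
      this power then add up to r, the coefficient in Bernoulli's inequality.\<close>
    also have "\<dots> \<le> (1 + 2 * \<beta> / real n) * (A * real n powr r) + A * (1 - \<beta>) * real n powr \<beta>"
    proof (intro add_mono mult_left_mono)
      have "1 \<le> real n powr \<beta>"
        using \<beta> Suc.hyps by (intro ge_one_powr_ge_zero) auto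
      then have "A * (1 - \<beta>) * 1 \<le> A * (1 - \<beta>) * real n powr \<beta>"
        using \<beta> A by (intro mult_left_mono) auto
      then show "C \<le> A * (1 - \<beta>) * real n powr \<beta>"
        using A by simp
    qed (use \<beta> Suc.IH in auto)
    also have "\<dots> = A * (real n powr r * (1 + r * (1 / real n)))"
    proof -
      have "real n powr r = real n * real n powr \<beta>"
        using Suc.hyps by (simp add: r_def powr_add)
      then show ?thesis
        using Suc.hyps by (simp add: field_simps r_def)
    qed
    also have "\<dots> \<le> A * (real n powr r * (1 + 1 / real n) powr r)"
      using A \<beta> Bernoulli_inequality_powr[of "1 / real n" r]
      by (intro mult_left_mono) (auto simp: r_def)
    also have "real n powr r * (1 + 1 / real n) powr r = real (Suc n) powr r"
    proof -
      have "real n * (1 + 1 / real n) = real (Suc n)"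
        using Suc.hyps by (simp add: field_simps)
      then show ?thesis
        by (simp flip: powr_mult)
    qed
    finally show ?case .
  qed
qed

text \<open>Between the consecutive sample points \<open>k\<^sup>m\<close> and \<open>(k + 1)\<^sup>m\<close>, whose ratio tends to 1, the bounded
  increments contribute only \<open>o(n)\<close>.\<close>

lemma LIMSEQ_average_of_power_subseq:
  fixes T :: "nat \<Rightarrow> 'v::real_normed_vector"
  assumes increments: "\<And>n. n \<ge> 1 \<Longrightarrow> norm (T (Suc n) - T n) \<le> B"
    and "m \<ge> 1"
    and subseq: "(\<lambda>k. T (k ^ m) /\<^sub>R real (k ^ m)) \<longlonglongrightarrow> 0"
  shows "(\<lambda>n. T n /\<^sub>R real n) \<longlonglongrightarrow> 0"
proof -
  \<comment> \<open>The integer part of the m-th root of n: \<open>k n ^ m\<close> is the last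
    sample point up to n.\<close>
  define k where "k = nth_root_nat m"
  have k_le: "k n ^ m \<le> n" and k_gt: "n < Suc (k n) ^ m" for n
    using assms(2) nth_root_nat_power_le[of m n] nth_root_nat_ge[of m "Suc (k n)" n]
    by (force simp: k_def not_less_eq_eq simp flip: not_le)+
  have k_top: "filterlim k at_top sequentially"
    unfolding filterlim_at_top
  proof
    fix l
    show "eventually (\<lambda>n. l \<le> k n) sequentially"
      using eventually_ge_at_top[of "l ^ m"]
      by eventually_elim (use assms(2) in \<open>auto simp: k_def intro: nth_root_nat_ge\<close>)
  qed
  have diff: "norm (T n - T l) \<le> B * real (n - l)" if "1 \<le> l" "l \<le> n" for l n
    using that(2,1)
  proof (induction n rule: dec_induct)
    case (step n)
    have "norm (T (Suc n) - T l) \<le> norm (T (Suc n) - T n) + norm (T n - T l)"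
      using norm_triangle_ineq[of "T (Suc n) - T n" "T n - T l"] by simp
    also have "\<dots> \<le> B + B * real (n - l)"
      using step increments by (intro add_mono) auto
    finally show ?case
      using step.hyps by (simp add: Suc_diff_le algebra_simps)
  qed auto
  have B: "B \<ge> 0"
    using increments[of 1] norm_ge_zero order_trans by blast
  \<comment> \<open>The value at the sample point plus B times the relative gap
    \<open>((k + 1) ^ m - k ^ m) / k ^ m\<close>, which tends to 0 because m is fixed.\<close>
  let ?u = "\<lambda>k. norm (T (k ^ m) /\<^sub>R real (k ^ m)) + B * ((real (Suc k) / real k) ^ m - 1)"
  have "(\<lambda>k. real (Suc k) / real k) \<longlonglongrightarrow> 1"
    by real_asymp
  then have "?u \<longlonglongrightarrow> 0 + B * (1 ^ m - 1)"
    by (intro tendsto_intros tendsto_norm_zero subseq)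
  then have "(\<lambda>n. ?u (k n)) \<longlonglongrightarrow> 0"
    using filterlim_compose[OF _ k_top, of ?u] by simp
  moreover have "eventually (\<lambda>n. norm (T n /\<^sub>R real n) \<le> ?u (k n)) sequentially"
    \<comment> \<open>\<open>k n \<ge> 1\<close> keeps the sample point away from index 0, where the
      increments are not controlled and the quotient is degenerate.\<close>
    using filterlim_at_top[THEN iffD1, OF k_top, rule_format, of 1]
  proof eventually_elim
    case (elim n)
    let ?l = "k n ^ m"
    have l: "1 \<le> ?l" "?l \<le> n"
      using elim k_le by auto
    have "norm (T n) \<le> norm (T ?l) + norm (T n - T ?l)"
      using norm_triangle_sub by blast
    also have "\<dots> \<le> norm (T ?l) + B * (real n - real ?l)"
      using diff[OF l] l by (simp add: of_nat_diff)
    finally have "norm (T n) / real n \<le> (norm (T ?l) + B * (real n - real ?l)) / real n"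
      by (intro divide_right_mono) auto
    also have "\<dots> \<le> (norm (T ?l) + B * (real n - real ?l)) / real ?l"
    proof (rule divide_left_mono)
      show "real ?l \<le> real n"
        using l by (simp del: of_nat_power)
      have "0 < n" "0 < ?l"
        using l by linarith+
      then show "0 < real n * real ?l"
        by (simp only: of_nat_0_less_iff mult_pos_pos)
      show "0 \<le> norm (T ?l) + B * (real n - real ?l)"
        using l B by (intro add_nonneg_nonneg mult_nonneg_nonneg) (auto simp del: of_nat_power)
    qed
    also have "\<dots> \<le> (norm (T ?l) + B * (real (Suc (k n) ^ m) - real ?l)) / real ?l"
      using k_gt[of n] B by (intro divide_right_mono add_left_mono mult_left_mono) (auto simp del: of_nat_power)
    also have "\<dots> = ?u (k n)"
      using l(1) elim by (simp add: field_simps power_divide del: of_nat_Suc)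
    finally show ?case
      by (simp add: divide_inverse_commute)
  qed
  ultimately show ?thesis
    by (rule Lim_null_comparison[rotated])
qed

section \<open>Probability: almost sure convergence from second moments, expectations as finite
  sums\<close>

text \<open>The squared norms of \<open>T n / n\<close> have expectations of order
  \<open>n powr (r - 2)\<close>, which need not be summable over all n but are along
  \<open>n = k ^ m\<close> for large m. Exchanging sum and integral, their sum is almost surely
  finite, so its terms tend to 0.\<close>

lemma (in prob_space) AE_LIMSEQ_average_of_second_moments:
  fixes T :: "nat \<Rightarrow> 'a \<Rightarrow> 'v::{real_normed_vector, second_countable_topology}"
  assumes T[measurable]: "\<And>n. T n \<in> borel_measurable M"
    and increments: "\<And>n \<omega>. n \<ge> 1 \<Longrightarrow> \<omega> \<in> space M \<Longrightarrow> norm (T (Suc n) \<omega> - T n \<omega>) \<le> B"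
    and integrable: "\<And>n. n \<ge> 1 \<Longrightarrow> integrable M (\<lambda>\<omega>. (norm (T n \<omega>))\<^sup>2)"
    and moments: "\<And>n. n \<ge> 1 \<Longrightarrow> expectation (\<lambda>\<omega>. (norm (T n \<omega>))\<^sup>2) \<le> A * real n powr r"
    and "r < 2"
  shows "AE \<omega> in M. (\<lambda>n. T n \<omega> /\<^sub>R real n) \<longlonglongrightarrow> 0"
proof -
  \<comment> \<open>This makes the exponent \<open>m * (r - 2)\<close> smaller than -1, the
    threshold for summability over k.\<close>
  obtain m where m: "1 / (2 - r) < real m"
    using reals_Archimedean2 by blast
  then have "m \<ge> 1"
    using \<open>r < 2\<close> by (cases m) (auto simp: divide_less_0_iff)
  have m': "real m * (r - 2) < -1"
    using m \<open>r < 2\<close> by (simp add: field_simps)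
  define z where "z k = (\<lambda>\<omega>. (norm (T (k ^ m) \<omega> /\<^sub>R real (k ^ m)))\<^sup>2)" for k
  have z[measurable]: "z k \<in> borel_measurable M" for k
    unfolding z_def by measurable
  have z_bound: "(\<integral>\<^sup>+\<omega>. ennreal (z k \<omega>) \<partial>M) \<le> ennreal (A * real k powr (real m * (r - 2)))" for k
  proof (cases "k = 0")
    \<comment> \<open>For \<open>k = 0\<close> both sides are 0: the inverse of 0 is 0, and so is
      every \<open>powr\<close> with base 0.\<close>
    case True
    then show ?thesis
      using \<open>m \<ge> 1\<close> by (simp add: z_def power_0_left)
  next
    case False
    have z_eq: "z k \<omega> = (norm (T (k ^ m) \<omega>))\<^sup>2 / (real (k ^ m))\<^sup>2" for \<omega>
      by (simp add: z_def power_mult_distrib divide_inverse power_inverse mult.commute)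
    have "(\<integral>\<^sup>+\<omega>. ennreal (z k \<omega>) \<partial>M) = ennreal (expectation (z k))"
      unfolding z_eq using False
      by (intro nn_integral_eq_integral integrable_divide integrable) auto
    also have "expectation (z k) = expectation (\<lambda>\<omega>. (norm (T (k ^ m) \<omega>))\<^sup>2) / (real (k ^ m))\<^sup>2"
      unfolding z_eq by simp
    also have "\<dots> \<le> A * real (k ^ m) powr r / (real (k ^ m))\<^sup>2"
      using False by (intro divide_right_mono moments) auto
    also have "\<dots> = A * (real (k ^ m) powr (r - 2))"
      using False by (simp add: powr_diff)
    also have "real (k ^ m) powr (r - 2) = real k powr (real m * (r - 2))"
      using False by (simp add: powr_powr flip: powr_realpow)
    finally show ?thesis
      by (simp add: ennreal_leI)
  qed
  \<comment> \<open>The moment bound at \<open>n = 1\<close> forces \<open>A \<ge> 0\<close>, so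
    that \<open>ennreal\<close> does not truncate the terms of the dominating series.\<close>
  have "0 \<le> expectation (\<lambda>\<omega>. (norm (T 1 \<omega>))\<^sup>2)"
    by simp
  also have "\<dots> \<le> A"
    using moments[of 1] by simp
  finally have A: "A \<ge> 0" .
  have "summable (\<lambda>k. A * real k powr (real m * (r - 2)))"
    using m' by (intro summable_mult) (simp add: summable_real_powr_iff)
  then have "(\<Sum>k. ennreal (A * real k powr (real m * (r - 2)))) \<noteq> \<top>"
    using A by (intro ennreal_suminf_neq_top) auto
  moreover have "(\<integral>\<^sup>+\<omega>. (\<Sum>k. ennreal (z k \<omega>)) \<partial>M)
      \<le> (\<Sum>k. ennreal (A * real k powr (real m * (r - 2))))"
    using z_bound by (subst nn_integral_suminf) (auto intro!: suminf_le)
  ultimately have "(\<integral>\<^sup>+\<omega>. (\<Sum>k. ennreal (z k \<omega>)) \<partial>M) \<noteq> \<infinity>"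
    by (auto simp: top_unique)
  then have "AE \<omega> in M. (\<Sum>k. ennreal (z k \<omega>)) \<noteq> \<infinity>"
    by (intro nn_integral_noteq_infinite) auto
  then show ?thesis
    using AE_space
  proof eventually_elim
    case (elim \<omega>)
    then have "summable (\<lambda>k. z k \<omega>)"
      by (intro summable_suminf_not_top) (auto simp: z_def)
    then have "(\<lambda>k. sqrt (z k \<omega>)) \<longlonglongrightarrow> sqrt 0"
      by (intro tendsto_real_sqrt summable_LIMSEQ_zero)
    then have "(\<lambda>k. T (k ^ m) \<omega> /\<^sub>R real (k ^ m)) \<longlonglongrightarrow> 0"
      unfolding z_def by (simp add: tendsto_norm_zero_iff del: norm_scaleR)
    then show ?case
      using increments elim(2) \<open>m \<ge> 1\<close> by (intro LIMSEQ_average_of_power_subseq[of "\<lambda>n. T n \<omega>" B m]) auto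
  qed
qed

text \<open>Stands in for conditional expectations: histories take finitely many values, so
  expectations become sums over atoms, to which the elementary conditional probabilities of the
  model apply.\<close>

lemma (in prob_space) expectation_finite_range:
  fixes h :: "'b \<Rightarrow> real"
  assumes "finite F" and W: "W \<in> M \<rightarrow>\<^sub>M count_space F"
  shows "expectation (\<lambda>\<omega>. h (W \<omega>)) = (\<Sum>w\<in>F. h w * prob {\<omega>\<in>space M. W \<omega> = w})"
    and "integrable M (\<lambda>\<omega>. h (W \<omega>))"
proof -
  have events: "{\<omega>\<in>space M. W \<omega> = w} \<in> events" if "w \<in> F" for w
    using measurable_sets[OF W, of "{w}"] that by (simp add: vimage_def Int_def conj_commute)
  have h: "h (W \<omega>) = (\<Sum>w\<in>F. h w * indicator {\<omega>\<in>space M. W \<omega> = w} \<omega>)" if "\<omega> \<in> space M" for \<omega>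
    using assms that measurable_space[OF W that] by (simp add: indicator_def sum.delta' if_distrib cong: if_cong)
  have int: "integrable M (\<lambda>\<omega>. h w * indicator {\<omega>\<in>space M. W \<omega> = w} \<omega>)" if "w \<in> F" for w
    using events[OF that] by (intro integrable_mult_right) (simp add: emeasure_eq_measure)
  have "expectation (\<lambda>\<omega>. h (W \<omega>)) = expectation (\<lambda>\<omega>. \<Sum>w\<in>F. h w * indicator {\<omega>\<in>space M. W \<omega> = w} \<omega>)"
    using h by (intro Bochner_Integration.integral_cong) auto
  also have "\<dots> = (\<Sum>w\<in>F. expectation (\<lambda>\<omega>. h w * indicator {\<omega>\<in>space M. W \<omega> = w} \<omega>))"
    using int by (rule Bochner_Integration.integral_sum)
  also have "\<dots> = (\<Sum>w\<in>F. h w * prob {\<omega>\<in>space M. W \<omega> = w})"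
    using events by (intro sum.cong) (auto simp: Int_absorb2)
  finally show "expectation (\<lambda>\<omega>. h (W \<omega>)) = (\<Sum>w\<in>F. h w * prob {\<omega>\<in>space M. W \<omega> = w})" .
  have "integrable M (\<lambda>\<omega>. \<Sum>w\<in>F. h w * indicator {\<omega>\<in>space M. W \<omega> = w} \<omega>)"
    using int by (rule Bochner_Integration.integrable_sum)
  then show "integrable M (\<lambda>\<omega>. h (W \<omega>))"
    using Bochner_Integration.integrable_cong[of M M "\<lambda>\<omega>. h (W \<omega>)", OF refl h] by simp
qed

section \<open>The set of directions and the mean of a perturbed direction\<close>

lemma finite_directions: "finite (directions K)"
  by (simp add: directions_def)

lemma axis_in_directions: "axis i 1 \<in> directions K"
  by (simp add: directions_def)

lemma norm_directions: "v \<in> directions K \<Longrightarrow> norm v \<le> 1"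
  by (auto simp: directions_def norm_axis_1 split: if_splits)

text \<open>The set is invariant under negation, so the sum equals its own negative.\<close>

lemma sum_directions: "(\<Sum>v\<in>directions K. v) = (0 :: real ^ 'd)"
proof -
  have "uminus ` directions K = (directions K :: (real ^ 'd) set)"
    by (auto simp: directions_def image_Un image_image)
  then have "(\<Sum>v\<in>directions K. v) = (\<Sum>v\<in>directions K. - v :: real ^ 'd)"
    using sum.reindex[of uminus "directions K :: (real ^ 'd) set" "\<lambda>v. v"] by simp
  then show ?thesis
    by (simp add: sum_negf eq_neg_iff_add_eq_0 flip: scaleR_2)
qed

text \<open>The law is the constant weight \<open>(1 - p) / (K - 1)\<close> on all directions plus
  the excess \<open>p - (1 - p) / (K - 1)\<close> at \<open>u\<close>. The constant part has mean 0
  by symmetry, and the excess is the factor claimed.\<close>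

lemma mean_perturb_directions:
  fixes u :: "real ^ 'd"
  assumes "K \<in> {2 * CARD('d), 2 * CARD('d) + 1}" "p \<in> {0..1}" and u: "u \<in> directions K"
  shows "(\<Sum>v\<in>directions K. pmf (perturb (directions K) p u) v *\<^sub>R v) =
    ((real K * p - 1) / (real K - 1)) *\<^sub>R u"
proof -
  let ?E = "directions K :: (real ^ 'd) set"
  have card: "card ?E = K"
    using assms(1) by (rule card_directions)
  have "K \<ge> 2"
    using assms(1) zero_less_card_finite[where 'a='d] by auto
  have "(\<Sum>v\<in>?E. pmf (perturb ?E p u) v *\<^sub>R v) =
      (\<Sum>v\<in>?E. ((1 - p) / (real K - 1)) *\<^sub>R v +
        (if v = u then (p - (1 - p) / (real K - 1)) *\<^sub>R v else 0))"
    using u assms(2) \<open>K \<ge> 2\<close>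
    by (intro sum.cong) (auto simp: pmf_perturb finite_directions card scaleR_left_diff_distrib)
  also have "\<dots> = (p - (1 - p) / (real K - 1)) *\<^sub>R u"
    using u by (simp add: sum.distrib sum_directions finite_directions flip: scaleR_sum_right)
  also have "p - (1 - p) / (real K - 1) = (real K * p - 1) / (real K - 1)"
    using \<open>K \<ge> 2\<close> by (simp add: field_simps)
  finally show ?thesis .
qed

section \<open>The conditional law of the next step given the history\<close>

context memory_walk
begin

abbreviation E :: "(real ^ 'd) set" where
  "E \<equiv> directions K"

text \<open>The restriction makes the history an element of the finite set \<open>paths n\<close>
  and matches the map whose sigma-algebra occurs in \<open>X_Y_indep\<close>.\<close>

abbreviation past :: "nat \<Rightarrow> 'a \<Rightarrow> nat \<Rightarrow> real ^ 'd" where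
  "past n \<omega> \<equiv> (\<lambda>i\<in>{1..n}. X i \<omega>)"

abbreviation paths :: "nat \<Rightarrow> (nat \<Rightarrow> real ^ 'd) set" where
  "paths n \<equiv> {1..n} \<rightarrow>\<^sub>E E"

text \<open>The factor a of the opening comment.\<close>

definition gain :: real where
  "gain = (real K * p - 1) / (real K - 1)"

lemma finite_paths: "finite (paths n)"
  by (intro finite_PiE) (auto simp: finite_directions)

lemma mean_next_step:
  assumes "n \<ge> 1" "x \<in> paths n"
  shows "(\<Sum>v\<in>E. pmf (next_step K p j n x y) v *\<^sub>R v) =
    gain *\<^sub>R (if y then (\<Sum>i=1..n. x i) /\<^sub>R real n else axis j 1)"
proof (cases y)
  case True
  have "(\<Sum>v\<in>E. pmf (next_step K p j n x y) v *\<^sub>R v) =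
      (\<Sum>v\<in>E. ((\<Sum>t=1..n. pmf (perturb E p (x t)) v) / real n) *\<^sub>R v)"
    using True assms(1) by (simp add: next_step_def pmf_bind_pmf_of_set)
  also have "\<dots> = (\<Sum>t=1..n. \<Sum>v\<in>E. pmf (perturb E p (x t)) v *\<^sub>R v) /\<^sub>R real n"
    by (subst sum.swap) (simp add: scaleR_sum_left scaleR_sum_right divide_inverse_commute flip: scaleR_scaleR)
  also have "\<dots> = (\<Sum>t=1..n. gain *\<^sub>R x t) /\<^sub>R real n"
    unfolding gain_def using assms(2) K p by (intro arg_cong2[where f = scaleR] sum.cong mean_perturb_directions) auto
  finally show ?thesis
    using True by (simp add: scaleR_left_commute flip: scaleR_sum_right)
next
  case False
  then show ?thesis
    using mean_perturb_directions[OF K p axis_in_directions] by (simp add: next_step_def gain_def)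
qed

lemma PiM_paths: "Pi\<^sub>M {1..n} (\<lambda>_. count_space E) = count_space (paths n)"
  by (intro count_space_PiM_finite) (auto simp: finite_directions countable_finite)

lemma past_measurable: "past n \<in> M \<rightarrow>\<^sub>M count_space (paths n)"
proof -
  have "past n \<in> M \<rightarrow>\<^sub>M Pi\<^sub>M {1..n} (\<lambda>_. count_space E)"
    using X_measurable by (intro measurable_restrict) auto
  also note PiM_paths
  finally show ?thesis .
qed

lemma Y_measurable: "n \<ge> 1 \<Longrightarrow> Y n \<in> M \<rightarrow>\<^sub>M count_space UNIV"
  using Y_indep unfolding indep_vars_def by auto

lemma prob_Y:
  assumes "n \<ge> 1"
  shows "prob {\<omega>\<in>space M. Y n \<omega> = y} = (if y then \<theta> else 1 - \<theta>)"
proof -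
  have "prob {\<omega>\<in>space M. Y n \<omega> = y} = measure (distr M (count_space UNIV) (Y n)) {y}"
    using Y_measurable[OF assms] by (subst measure_distr) (auto intro!: arg_cong[where f = prob])
  also have "\<dots> = pmf (bernoulli_pmf \<theta>) y"
    by (simp add: Y_distr[OF assms] measure_pmf_single)
  finally show ?thesis
    using theta by (cases y) auto
qed

text \<open>By \<open>PiM_paths\<close> the product sigma-algebra on histories is discrete, so
  fixing a history is an event of the sigma-algebra that is independent of the coin.\<close>

lemma prob_past_Y:
  assumes "n \<ge> 1" "x \<in> paths n"
  shows "prob {\<omega>\<in>space M. past n \<omega> = x \<and> Y n \<omega> = y} =
    prob {\<omega>\<in>space M. past n \<omega> = x} * (if y then \<theta> else 1 - \<theta>)"
proof -
  have "past n -` {x} \<inter> space M \<in> sets (vimage_algebra (space M) (past n) (Pi\<^sub>M {1..n} (\<lambda>_. count_space E)))"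
    using assms(2) unfolding PiM_paths by (intro in_vimage_algebra) simp
  moreover have "Y n -` {y} \<inter> space M \<in> sets (vimage_algebra (space M) (Y n) (count_space UNIV))"
    by (intro in_vimage_algebra) simp
  ultimately have "prob ((past n -` {x} \<inter> space M) \<inter> (Y n -` {y} \<inter> space M)) =
      prob (past n -` {x} \<inter> space M) * prob (Y n -` {y} \<inter> space M)"
    by (rule indep_setD[OF X_Y_indep[OF assms(1)]])
  moreover have "(past n -` {x} \<inter> space M) \<inter> (Y n -` {y} \<inter> space M) = {\<omega>\<in>space M. past n \<omega> = x \<and> Y n \<omega> = y}"
    "past n -` {x} \<inter> space M = {\<omega>\<in>space M. past n \<omega> = x}"
    "Y n -` {y} \<inter> space M = {\<omega>\<in>space M. Y n \<omega> = y}"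
    by auto
  ultimately show ?thesis
    using prob_Y[OF assms(1)] by simp
qed

text \<open>The multiplication rule, extended to null histories, where both sides vanish and the
  conditional law says nothing.\<close>

lemma prob_past_Y_step:
  assumes "n \<ge> 1" "x \<in> paths n" "v \<in> E"
  shows "prob {\<omega>\<in>space M. past n \<omega> = x \<and> Y n \<omega> = y \<and> X (Suc n) \<omega> = v} =
    prob {\<omega>\<in>space M. past n \<omega> = x \<and> Y n \<omega> = y} * pmf (next_step K p j n x y) v"
proof -
  \<comment> \<open>Since \<open>x\<close> is extensional, equality with the restricted history only
    concerns the indices 1 to n, as in \<open>X_step\<close>.\<close>
  have past_eq: "past n \<omega> = x \<longleftrightarrow> (\<forall>i\<in>{1..n}. X i \<omega> = x i)" for \<omega>
    using assms(2) by (auto simp: restrict_def fun_eq_iff PiE_def extensional_def)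
  let ?A = "{\<omega>\<in>space M. past n \<omega> = x \<and> Y n \<omega> = y}"
  let ?B = "{\<omega>\<in>space M. past n \<omega> = x \<and> Y n \<omega> = y \<and> X (Suc n) \<omega> = v}"
  show ?thesis
  proof (cases "prob ?A = 0")
    case True
    have "?A = (past n -` {x} \<inter> space M) \<inter> (Y n -` {y} \<inter> space M)"
      by auto
    then have "?A \<in> events"
      using measurable_sets[OF past_measurable, of "{x}" n] assms(2)
        measurable_sets[OF Y_measurable[OF assms(1)], of "{y}"] by simp
    then have "prob ?B \<le> prob ?A"
      by (intro finite_measure_mono) auto
    then have "prob ?B = 0"
      using True measure_nonneg[of M ?B] by linarith
    then show ?thesis
      using True by simp
  next
    case False
    then have "prob ?A > 0"
      by (simp add: less_le)
    then have "cond_prob M (\<lambda>\<omega>. X (n + 1) \<omega> = v) (\<lambda>\<omega>. past n \<omega> = x \<and> Y n \<omega> = y) = pmf (next_step K p j n x y) v"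
      unfolding past_eq by (rule X_step[OF assms(1)])
    then show ?thesis
      using False by (simp add: cond_prob_def field_simps conj_ac)
  qed
qed

text \<open>The drift formula for the conditional mean of the next step, in weak form: it is tested
  against an arbitrary function \<open>f\<close> of the history.\<close>

lemma expectation_inner_step:
  assumes "n \<ge> 1"
  shows "expectation (\<lambda>\<omega>. f (past n \<omega>) \<bullet> X (Suc n) \<omega>) =
    expectation (\<lambda>\<omega>. f (past n \<omega>) \<bullet>
      ((\<theta> * gain / real n) *\<^sub>R position X n \<omega> + ((1 - \<theta>) * gain) *\<^sub>R axis j 1))"
proof -
  let ?W = "\<lambda>\<omega>. (past n \<omega>, Y n \<omega>, X (Suc n) \<omega>)"
  let ?F = "paths n \<times> (UNIV :: bool set) \<times> E"
  let ?P = "\<lambda>x. prob {\<omega>\<in>space M. past n \<omega> = x}"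
  have "?W \<in> M \<rightarrow>\<^sub>M count_space (paths n) \<Otimes>\<^sub>M (count_space UNIV \<Otimes>\<^sub>M count_space E)"
    using past_measurable Y_measurable[OF assms] X_measurable[of "Suc n"] by measurable
  also have "count_space (paths n) \<Otimes>\<^sub>M (count_space (UNIV :: bool set) \<Otimes>\<^sub>M count_space E) = count_space ?F"
    using countable_finite[OF finite_paths[of n]]
    by (simp add: pair_measure_countable countable_finite finite_directions)
  finally have W: "?W \<in> M \<rightarrow>\<^sub>M count_space ?F" .
  have "finite ?F"
    by (intro finite_cartesian_product finite_paths finite_directions finite)
  then have "expectation (\<lambda>\<omega>. f (past n \<omega>) \<bullet> X (Suc n) \<omega>) =
      (\<Sum>w\<in>?F. (f (fst w) \<bullet> snd (snd w)) * prob {\<omega>\<in>space M. ?W \<omega> = w})"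
    using expectation_finite_range(1)[OF _ W, of "\<lambda>w. f (fst w) \<bullet> snd (snd w)"]
    by (simp only: fst_conv snd_conv)
  also have "\<dots> = (\<Sum>x\<in>paths n. \<Sum>y\<in>UNIV. \<Sum>v\<in>E. (f x \<bullet> v) * prob {\<omega>\<in>space M. past n \<omega> = x \<and> Y n \<omega> = y \<and> X (Suc n) \<omega> = v})"
    by (simp add: sum.cartesian_product case_prod_beta prod_eq_iff)
  \<comment> \<open>History, coin and step probabilities factor; the sum over \<open>v\<close>
    leaves the conditional mean of the step.\<close>
  also have "\<dots> = (\<Sum>x\<in>paths n. \<Sum>y\<in>UNIV. ?P x * (if y then \<theta> else 1 - \<theta>) *
      (f x \<bullet> (\<Sum>v\<in>E. pmf (next_step K p j n x y) v *\<^sub>R v)))"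
  proof (intro sum.cong refl)
    fix x y
    assume "x \<in> paths n"
    then have "(\<Sum>v\<in>E. (f x \<bullet> v) * prob {\<omega>\<in>space M. past n \<omega> = x \<and> Y n \<omega> = y \<and> X (Suc n) \<omega> = v}) =
        (\<Sum>v\<in>E. (f x \<bullet> v) * (?P x * (if y then \<theta> else 1 - \<theta>) * pmf (next_step K p j n x y) v))"
      using assms by (intro sum.cong refl) (simp only: prob_past_Y_step prob_past_Y)
    also have "\<dots> = ?P x * (if y then \<theta> else 1 - \<theta>) *
        (f x \<bullet> (\<Sum>v\<in>E. pmf (next_step K p j n x y) v *\<^sub>R v))"
      by (simp only: inner_sum_right inner_scaleR_right sum_distrib_left, simp only: mult_ac)
    finally show "(\<Sum>v\<in>E. (f x \<bullet> v) * prob {\<omega>\<in>space M. past n \<omega> = x \<and> Y n \<omega> = y \<and> X (Suc n) \<omega> = v}) =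
        ?P x * (if y then \<theta> else 1 - \<theta>) * (f x \<bullet> (\<Sum>v\<in>E. pmf (next_step K p j n x y) v *\<^sub>R v))" .
  qed
  \<comment> \<open>Averaging over the coin weights the empirical mean by \<theta> and the first
    axis by 1 - \<theta>.\<close>
  also have "\<dots> = (\<Sum>x\<in>paths n. (f x \<bullet>
      ((\<theta> * gain / real n) *\<^sub>R (\<Sum>i=1..n. x i) + ((1 - \<theta>) * gain) *\<^sub>R axis j 1)) * ?P x)"
    using assms by (intro sum.cong refl)
      (simp add: mean_next_step UNIV_bool inner_add_right divide_inverse algebra_simps)
  also have "\<dots> = expectation (\<lambda>\<omega>. f (past n \<omega>) \<bullet>
      ((\<theta> * gain / real n) *\<^sub>R (\<Sum>i=1..n. past n \<omega> i) + ((1 - \<theta>) * gain) *\<^sub>R axis j 1))"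
    by (rule expectation_finite_range(1)[OF finite_paths past_measurable, symmetric])
  finally show ?thesis
    by (simp add: position_def)
qed

section \<open>The centred walk and its second moments\<close>

text \<open>The constant c of the opening comment: for \<theta> a different from 1, the solution of
  c = \<theta> a c + (1 - \<theta>) a, with a the \<open>gain\<close>.\<close>

definition speed :: real where
  "speed = (1 - \<theta>) * gain / (1 - \<theta> * gain)"

definition centred :: "nat \<Rightarrow> 'a \<Rightarrow> real ^ 'd" where
  "centred n \<omega> = position X n \<omega> - (real n * speed) *\<^sub>R axis j 1"

lemma centred_Suc: "centred (Suc n) \<omega> = centred n \<omega> + (X (Suc n) \<omega> - speed *\<^sub>R axis j 1)"
  by (simp add: centred_def position_def algebra_simps)

lemma X_in_directions: "n \<ge> 1 \<Longrightarrow> \<omega> \<in> space M \<Longrightarrow> X n \<omega> \<in> E"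
  using measurable_space[OF X_measurable] by simp

lemma norm_increment_le:
  assumes "n \<ge> 1" "\<omega> \<in> space M"
  shows "norm (X n \<omega> - speed *\<^sub>R axis j 1) \<le> 1 + \<bar>speed\<bar>"
  using norm_triangle_ineq4[of "X n \<omega>" "speed *\<^sub>R axis j 1"] norm_directions[OF X_in_directions[OF assms]]
  by (simp add: norm_axis_1)

text \<open>Lets the centred walk itself serve as the test function in
  \<open>expectation_inner_step\<close>.\<close>

lemma centred_eq_past:
  "centred n \<omega> = (\<Sum>i=1..n. past n \<omega> i) - (real n * speed) *\<^sub>R axis j 1"
  by (simp add: centred_def position_def)

lemma X_borel_measurable: "n \<ge> 1 \<Longrightarrow> X n \<in> borel_measurable M"
  using measurable_compose[OF X_measurable, of n "\<lambda>v. v" borel] by simp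

lemma centred_measurable: "centred n \<in> borel_measurable M"
  unfolding centred_def position_def using X_borel_measurable by measurable

lemma centred_bounded:
  assumes "\<omega> \<in> space M"
  shows "norm (centred n \<omega>) \<le> real n * (1 + \<bar>speed\<bar>)"
proof (induction n)
  case 0
  then show ?case by (simp add: centred_def position_def)
next
  case (Suc n)
  have "norm (centred (Suc n) \<omega>) \<le> norm (centred n \<omega>) + norm (X (Suc n) \<omega> - speed *\<^sub>R axis j 1)"
    unfolding centred_Suc by (rule norm_triangle_ineq)
  then show ?case
    using Suc norm_increment_le[of "Suc n", OF _ assms] by (simp add: algebra_simps)
qed

lemma integrable_centred_inner:
  "integrable M (\<lambda>\<omega>. centred n \<omega> \<bullet> centred n \<omega>)"
  "integrable M (\<lambda>\<omega>. centred n \<omega> \<bullet> (X (Suc n) \<omega> - speed *\<^sub>R axis j 1))"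
  "integrable M (\<lambda>\<omega>. (X (Suc n) \<omega> - speed *\<^sub>R axis j 1) \<bullet> (X (Suc n) \<omega> - speed *\<^sub>R axis j 1))"
proof -
  let ?D = "\<lambda>\<omega>. X (Suc n) \<omega> - speed *\<^sub>R axis j 1"
  have bounded: "integrable M (\<lambda>\<omega>. U \<omega> \<bullet> V \<omega>)"
    if [measurable]: "U \<in> borel_measurable M" "V \<in> borel_measurable M"
      and "\<And>\<omega>. \<omega> \<in> space M \<Longrightarrow> norm (U \<omega>) \<le> b" "\<And>\<omega>. \<omega> \<in> space M \<Longrightarrow> norm (V \<omega>) \<le> c"
    for U V :: "'a \<Rightarrow> real ^ 'd" and b c
  proof (rule integrable_const_bound[of _ "b * c"])
    show "AE \<omega> in M. norm (U \<omega> \<bullet> V \<omega>) \<le> b * c"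
    proof (rule AE_I2)
      fix \<omega> assume "\<omega> \<in> space M"
      then have "norm (U \<omega>) * norm (V \<omega>) \<le> b * c"
        using that(3,4) norm_ge_zero order_trans by (intro mult_mono) blast+
      then show "norm (U \<omega> \<bullet> V \<omega>) \<le> b * c"
        using Cauchy_Schwarz_ineq2[of "U \<omega>" "V \<omega>"] by simp
    qed
  qed measurable
  have D: "?D \<in> borel_measurable M"
    using X_borel_measurable[of "Suc n"] by measurable
  note C = centred_measurable[of n] and bounds = centred_bounded norm_increment_le[of "Suc n", simplified]
  show "integrable M (\<lambda>\<omega>. centred n \<omega> \<bullet> centred n \<omega>)"
    by (rule bounded[OF C C bounds(1) bounds(1)])
  show "integrable M (\<lambda>\<omega>. centred n \<omega> \<bullet> ?D \<omega>)"
    by (rule bounded[OF C D bounds])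
  show "integrable M (\<lambda>\<omega>. ?D \<omega> \<bullet> ?D \<omega>)"
    by (rule bounded[OF D D bounds(2) bounds(2)])
qed

lemma expectation_centred_inner_increment:
  assumes "n \<ge> 1" "\<theta> * gain \<noteq> 1"
  shows "expectation (\<lambda>\<omega>. centred n \<omega> \<bullet> (X (Suc n) \<omega> - speed *\<^sub>R axis j 1)) =
    \<theta> * gain / real n * expectation (\<lambda>\<omega>. centred n \<omega> \<bullet> centred n \<omega>)"
proof -
  let ?e = "axis j 1 :: real ^ 'd"
  let ?f = "\<lambda>x. (\<Sum>i=1..n. x i) - (real n * speed) *\<^sub>R ?e"
  have fin: "integrable M (\<lambda>\<omega>. h (past n \<omega>))" for h :: "_ \<Rightarrow> real"
    by (rule expectation_finite_range(2)[OF finite_paths past_measurable])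
  \<comment> \<open>The fixed-point equation for \<open>speed\<close> leaves -\<theta> a c as
    coefficient of the axis, which is \<theta> a / n times the centring term -n c.\<close>
  have drift: "(\<theta> * gain / real n) *\<^sub>R position X n \<omega> + ((1 - \<theta>) * gain) *\<^sub>R ?e - speed *\<^sub>R ?e =
      (\<theta> * gain / real n) *\<^sub>R centred n \<omega>" for \<omega>
  proof -
    have "speed * (1 - \<theta> * gain) = (1 - \<theta>) * gain"
      using assms(2) by (simp add: speed_def)
    then have "(1 - \<theta>) * gain = speed - \<theta> * gain * speed"
      by (simp add: algebra_simps)
    then show ?thesis
      using assms(1) by (simp only:, simp add: centred_def algebra_simps)
  qed
  have int_e: "integrable M (\<lambda>\<omega>. centred n \<omega> \<bullet> (speed *\<^sub>R ?e))"
    unfolding centred_eq_past by (rule fin)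
  have int_S: "integrable M (\<lambda>\<omega>. centred n \<omega> \<bullet>
      ((\<theta> * gain / real n) *\<^sub>R position X n \<omega> + ((1 - \<theta>) * gain) *\<^sub>R ?e))"
    using fin[of "\<lambda>x. ?f x \<bullet> ((\<theta> * gain / real n) *\<^sub>R (\<Sum>i=1..n. x i) + ((1 - \<theta>) * gain) *\<^sub>R ?e)"]
    by (simp add: centred_def position_def)
  have int_X: "integrable M (\<lambda>\<omega>. centred n \<omega> \<bullet> X (Suc n) \<omega>)"
    using Bochner_Integration.integrable_add[OF integrable_centred_inner(2)[of n] int_e]
    by (simp add: inner_diff_right)
  have "expectation (\<lambda>\<omega>. centred n \<omega> \<bullet> (X (Suc n) \<omega> - speed *\<^sub>R ?e)) =
      expectation (\<lambda>\<omega>. centred n \<omega> \<bullet> X (Suc n) \<omega>) - expectation (\<lambda>\<omega>. centred n \<omega> \<bullet> (speed *\<^sub>R ?e))"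
    unfolding inner_diff_right by (rule Bochner_Integration.integral_diff[OF int_X int_e])
  also have "expectation (\<lambda>\<omega>. centred n \<omega> \<bullet> X (Suc n) \<omega>) = expectation (\<lambda>\<omega>. centred n \<omega> \<bullet>
      ((\<theta> * gain / real n) *\<^sub>R position X n \<omega> + ((1 - \<theta>) * gain) *\<^sub>R ?e))"
    unfolding centred_eq_past by (rule expectation_inner_step[OF assms(1), of ?f])
  also have "\<dots> - expectation (\<lambda>\<omega>. centred n \<omega> \<bullet> (speed *\<^sub>R ?e)) =
      expectation (\<lambda>\<omega>. centred n \<omega> \<bullet> ((\<theta> * gain / real n) *\<^sub>R centred n \<omega>))"
    unfolding drift[symmetric] inner_diff_right
    by (rule Bochner_Integration.integral_diff[OF int_S int_e, symmetric])
  finally show ?thesis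
    by simp
qed

text \<open>In the expanded square the cross term contributes 2 \<theta> a / n times the second
  moment, and the squared increment is bounded by a constant.\<close>

lemma second_moment_step:
  assumes "n \<ge> 1" "\<theta> * gain \<noteq> 1"
  shows "expectation (\<lambda>\<omega>. (norm (centred (Suc n) \<omega>))\<^sup>2) \<le>
    (1 + 2 * (\<theta> * gain) / real n) * expectation (\<lambda>\<omega>. (norm (centred n \<omega>))\<^sup>2) + (1 + \<bar>speed\<bar>)\<^sup>2"
proof -
  let ?D = "\<lambda>\<omega>. X (Suc n) \<omega> - speed *\<^sub>R axis j 1"
  have square: "(u + v) \<bullet> (u + v) = u \<bullet> u + 2 * (u \<bullet> v) + v \<bullet> v" for u v :: "real ^ 'd"
    by (simp add: inner_add_left inner_add_right inner_commute)
  have "expectation (\<lambda>\<omega>. (norm (centred (Suc n) \<omega>))\<^sup>2) =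
      expectation (\<lambda>\<omega>. centred n \<omega> \<bullet> centred n \<omega> + 2 * (centred n \<omega> \<bullet> ?D \<omega>) + ?D \<omega> \<bullet> ?D \<omega>)"
    unfolding centred_Suc power2_norm_eq_inner square by simp
  also have "\<dots> = expectation (\<lambda>\<omega>. centred n \<omega> \<bullet> centred n \<omega>)
      + 2 * expectation (\<lambda>\<omega>. centred n \<omega> \<bullet> ?D \<omega>) + expectation (\<lambda>\<omega>. ?D \<omega> \<bullet> ?D \<omega>)"
    using integrable_centred_inner[of n] by simp
  also have "expectation (\<lambda>\<omega>. ?D \<omega> \<bullet> ?D \<omega>) \<le> expectation (\<lambda>\<omega>. (1 + \<bar>speed\<bar>)\<^sup>2)"
    using norm_increment_le[of "Suc n"]
    by (intro integral_mono integrable_centred_inner) (auto intro!: power_mono simp flip: power2_norm_eq_inner)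
  finally show ?thesis
    using expectation_centred_inner_increment[OF assms]
    by (simp add: power2_norm_eq_inner prob_space algebra_simps)
qed

lemma AE_LIMSEQ_centred:
  assumes "\<theta> * gain < 1"
  shows "AE \<omega> in M. (\<lambda>n. centred n \<omega> /\<^sub>R real n) \<longlonglongrightarrow> 0"
proof (rule growth_exponent_less_2)
  show "\<theta> * gain < 1" "(1 + \<bar>speed\<bar>)\<^sup>2 \<ge> 0" "\<And>n. expectation (\<lambda>\<omega>. (norm (centred n \<omega>))\<^sup>2) \<ge> 0"
    using assms by simp_all
  show "expectation (\<lambda>\<omega>. (norm (centred (Suc n) \<omega>))\<^sup>2) \<le>
      (1 + 2 * (\<theta> * gain) / real n) * expectation (\<lambda>\<omega>. (norm (centred n \<omega>))\<^sup>2) + (1 + \<bar>speed\<bar>)\<^sup>2"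
    if "n \<ge> 1" for n
    using second_moment_step that assms by simp
next
  fix A r :: real
  assume "r < 2"
    and "\<And>n. n \<ge> 1 \<Longrightarrow> expectation (\<lambda>\<omega>. (norm (centred n \<omega>))\<^sup>2) \<le> A * real n powr r"
  then show ?thesis
    using norm_increment_le integrable_centred_inner(1)
    by (intro AE_LIMSEQ_average_of_second_moments[where B = "1 + \<bar>speed\<bar>"] centred_measurable)
      (auto simp: centred_Suc power2_norm_eq_inner)
qed

end

section \<open>Identification of the limit\<close>

theorem theorem2p1:
  fixes M :: "'a measure" and K :: nat and p \<theta> :: real and j :: "'d::finite"
    and X :: "nat \<Rightarrow> 'a \<Rightarrow> real ^ 'd" and Y :: "nat \<Rightarrow> 'a \<Rightarrow> bool"
  assumes "memory_walk M K p \<theta> j X Y"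
    and "real K - 1 + \<theta> * (1 - real K * p) \<noteq> 0"
  shows "AE \<omega> in M. (\<lambda>n. position X n \<omega> /\<^sub>R real n) \<longlonglongrightarrow>
    ((1 - \<theta>) * (real K * p - 1) / (real K - 1 + \<theta> * (1 - real K * p))) *\<^sub>R axis j 1"
proof -
  interpret memory_walk M K p \<theta> j X Y
    by fact
  have "K \<ge> 2"
    using K zero_less_card_finite[where 'a='d] by auto
  then have gain: "\<theta> * gain = \<theta> * (real K * p - 1) / (real K - 1)"
    and speed: "speed = (1 - \<theta>) * (real K * p - 1) / (real K - 1 + \<theta> * (1 - real K * p))"
    by (auto simp: gain_def speed_def divide_simps) (auto simp: algebra_simps)
  have "real K * p \<le> real K"
    using p by (simp add: mult_left_le)
  have "\<theta> * (real K * p - 1) \<le> real K - 1"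
  proof (cases "real K * p \<ge> 1")
    case True
    then show ?thesis
      using mult_mono[of \<theta> 1 "real K * p - 1" "real K - 1"] \<open>real K * p \<le> real K\<close> theta \<open>K \<ge> 2\<close> by simp
  next
    case False
    then have "\<theta> * (real K * p - 1) \<le> 0"
      using theta by (intro mult_nonneg_nonpos) auto
    then show ?thesis
      using \<open>K \<ge> 2\<close> by simp
  qed
  \<comment> \<open>Equality would make the denominator vanish, which happens only for \<theta> = p
    = 1; then almost surely every step repeats the first one, whose law is arbitrary.\<close>
  then have "\<theta> * gain < 1"
    using assms(2) \<open>K \<ge> 2\<close> unfolding gain by (simp add: field_simps less_le)
  from AE_LIMSEQ_centred[OF this] show ?thesis
  proof eventually_elim
    case (elim \<omega>)
    then have "(\<lambda>n. centred n \<omega> /\<^sub>R real n + speed *\<^sub>R axis j 1) \<longlonglongrightarrow> 0 + speed *\<^sub>R axis j 1"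
      by (intro tendsto_intros)
    \<comment> \<open>Only for positive n: at \<open>n = 0\<close> the right side is 0 by the
      convention for division, while the left is \<open>speed *\<^sub>R axis j 1\<close>.\<close>
    moreover have "eventually (\<lambda>n. centred n \<omega> /\<^sub>R real n + speed *\<^sub>R axis j 1 = position X n \<omega> /\<^sub>R real n) sequentially"
      using eventually_gt_at_top[of 0]
      by eventually_elim (simp add: centred_def algebra_simps)
    ultimately show ?case
      unfolding speed[symmetric] by (auto intro: Lim_transform_eventually)
  qed
qed

end
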